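(* Let $\mathbf{u}$ be a Parry word (simple or non-simple), i.e. the fixed point of a Parry substitution $\varphi$, and let $U_j=|\varphi^j(0)|$ for $j\ge0$. If $\mathbf{u}$ is $c$-balanced for some $c>0$, then the balance function of $\mathbf{u}$, $$B_{\mathbf{u}}(n)=\max\left\{\bigl||w|_a-|w'|_a\bigr| : a\in\mathcal{A},\ w,w'\text{ factors of }\mathbf{u},\ |w|=|w'|=n\right\},$$ can be evaluated by a deterministic finite automaton with output reading $\langle n\rangle_U$; that is, the sequence $(B_{\mathbf{u}}(n))_{n=1}^\infty$ is $U$-automatic.
   Context: $\mathbb{N}=\{1,2,3,\dots\}$. For a finite word $w$, $|w|$ is its length and $|w|_\ell$ the number of occurrences of the letter $\ell$ in $w$. Parry words. A simple Parry word over $\mathcal{A}=\{0,1,\dots,m-1\}$ ($m\ge 2$) is the fixed point $\mathbf{u}=u_0u_1u_2\cdots$ of the substitution $\varphi(\ell)=0^{\alpha_\ell}(\ell+1)$ for $0\le \ell\le m-2$, $\varphi(m-1)=0^{\alpha_{m-1}}$. A non-simple Parry word over $\mathcal{A}=\{0,1,\dots,m+p-1\}$ ($m,p\ge1$) is the fixed point $\mathbf{u}=u_0u_1u_2\cdots$ of $\varphi(\ell)=0^{\alpha_\ell}(\ell+1)$ for $0\le\ell\le m+p-2$, $\varphi(m+p-1)=0^{\alpha_{m+p-1}}m$. The $\alpha_\ell$ are non-negative integers with $\alpha_0\ge1$ and $\alpha_\ell\le\alpha_0$ for all $\ell\in\mathcal{A}$; in the simple case $\alpha_{m-1}\ge1$;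 in the non-simple case $\alpha_\ell\ge1$ for some $\ell\in\{m,\dots,m+p-1\}$. Moreover they satisfy Parry's condition: putting $t=\alpha_0\cdots\alpha_{m-1}0^\omega$ (simple case) or $t=\alpha_0\cdots\alpha_{m-1}(\alpha_m\cdots\alpha_{m+p-1})^\omega$ (non-simple case), every shift $t_it_{i+1}\cdots$ with $i\ge1$ is strictly lexicographically smaller than $t=t_0t_1\cdots$. Normal $U$-representation. For $n\in\mathbb{N}$, $\langle n\rangle_U=d_kd_{k-1}\cdots d_0$ is the word of digits of the expansion $n=\sum_{j=0}^k d_jU_j$ obtained by the greedy algorithm ($U_k\le n<U_{k+1}$, so $d_k\neq0$); all digits lie in $\{0,1,\dots,\alpha_0\}$. $c$-balanced: $\bigl||v|_\ell-|w|_\ell\bigr|\le c$ for every $\ell\in\mathcal{A}$ and all factors $v,w$ of $\mathbf{u}$ with $|v|=|w|$. $U$-automatic. A deterministic finite automaton with output (DFAO) is a 6-tuple $(Q,\Sigma,\delta,q_0,\Delta,\tau)$ with $Q$ a finite set of states, $\Sigma$ a finite input alphabet, $\delta:Q\times\Sigma\to Q$, $q_0\in Q$, $\Delta$ a finite output alphabet and $\tau:Q\to\Delta$; $\delta$ is extended to $Q\times\Sigma^*$ by $\delta(q,\epsilon)=q$, $\delta(q,xa)=\delta(\delta(q,x),a)$. A sequence $(a_n)_{n\in\mathbb{N}}$ with values in a finite set $\Delta$ is $U$-automatic if there is a DFAO with $\Sigma=\{0,1,\dots,\alpha_0\}$ such that $a_n=\tau(\delta(q_0,\langle n\rangle_U))$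 for all $n\in\mathbb{N}$. *)

theory Defs
  imports
    Main
    "HOL-Library.Omega_Words_Fun"
    "HOL-Library.Fun_Lexorder"
begin

section \<open>Parry words\<close>

text \<open>
  Letters are natural numbers; infinite words are functions on \<^typ>\<open>nat\<close> as in
  Omega_Words_Fun. Values of a substitution outside its alphabet are irrelevant, since the words
  it is applied to below only contain letters of the alphabet.
\<close>

definition simple_parry_subst :: "nat \<Rightarrow> (nat \<Rightarrow> nat) \<Rightarrow> nat \<Rightarrow> nat list" where
  "simple_parry_subst m \<alpha> l =
     (if Suc l < m then replicate (\<alpha> l) 0 @ [Suc l] else replicate (\<alpha> l) 0)"

definition nonsimple_parry_subst :: "nat \<Rightarrow> nat \<Rightarrow> (nat \<Rightarrow> nat) \<Rightarrow> nat \<Rightarrow> nat list" where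
  "nonsimple_parry_subst m p \<alpha> l =
     (if Suc l < m + p then replicate (\<alpha> l) 0 @ [Suc l] else replicate (\<alpha> l) 0 @ [m])"

definition parry_condition :: "nat word \<Rightarrow> bool" where
  "parry_condition t \<longleftrightarrow> (\<forall>i\<ge>1. less_fun (suffix i t) t)"

definition simple_parry_params :: "nat \<Rightarrow> (nat \<Rightarrow> nat) \<Rightarrow> bool" where
  "simple_parry_params m \<alpha> \<longleftrightarrow>
     m \<ge> 2 \<and> \<alpha> 0 \<ge> 1 \<and> (\<forall>l<m. \<alpha> l \<le> \<alpha> 0) \<and> \<alpha> (m - 1) \<ge> 1 \<and>
     parry_condition (map \<alpha> [0..<m] \<frown> [0]\<^sup>\<omega>)"

definition nonsimple_parry_params :: "nat \<Rightarrow> nat \<Rightarrow> (nat \<Rightarrow> nat) \<Rightarrow> bool" where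
  "nonsimple_parry_params m p \<alpha> \<longleftrightarrow>
     m \<ge> 1 \<and> p \<ge> 1 \<and> \<alpha> 0 \<ge> 1 \<and> (\<forall>l<m + p. \<alpha> l \<le> \<alpha> 0) \<and> (\<exists>l\<in>{m..<m + p}. \<alpha> l \<ge> 1) \<and>
     parry_condition (map \<alpha> [0..<m] \<frown> (map \<alpha> [m..<m + p])\<^sup>\<omega>)"

text \<open>\<open>\<phi>\<close> is a (simple or non-simple) Parry substitution over the alphabet \<open>{0,\<dots>,d - 1}\<close>.\<close>

definition parry_substitution :: "nat \<Rightarrow> (nat \<Rightarrow> nat) \<Rightarrow> (nat \<Rightarrow> nat list) \<Rightarrow> bool" where
  "parry_substitution d \<alpha> \<phi> \<longleftrightarrow>
     (\<exists>m. d = m \<and> simple_parry_params m \<alpha> \<and> \<phi> = simple_parry_subst m \<alpha>) \<or>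
     (\<exists>m p. d = m + p \<and> nonsimple_parry_params m p \<alpha> \<and> \<phi> = nonsimple_parry_subst m p \<alpha>)"

definition subst_word :: "('a \<Rightarrow> 'a list) \<Rightarrow> 'a list \<Rightarrow> 'a list" where
  "subst_word \<phi> w = concat (map \<phi> w)"

text \<open>
  \<open>u = \<phi>(u\<^sub>0)\<phi>(u\<^sub>1)\<phi>(u\<^sub>2)\<dots>\<close>, expressed through the finite prefixes of \<open>u\<close>. This determines
  the whole of \<open>\<phi>(u)\<close> because Parry substitutions are non-erasing.
\<close>

definition is_fixed_point :: "'a set \<Rightarrow> ('a \<Rightarrow> 'a list) \<Rightarrow> 'a word \<Rightarrow> bool" where
  "is_fixed_point A \<phi> u \<longleftrightarrow>
     range u \<subseteq> A \<and>
     (\<forall>n. subst_word \<phi> (prefix n u) = prefix (length (subst_word \<phi> (prefix n u))) u)"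

section \<open>Factors and balance\<close>

definition is_factor :: "'a list \<Rightarrow> 'a word \<Rightarrow> bool" where
  "is_factor w u \<longleftrightarrow> (\<exists>i j. w = (u [i \<rightarrow> j]))"

definition balanced :: "'a set \<Rightarrow> nat \<Rightarrow> 'a word \<Rightarrow> bool" where
  "balanced A c u \<longleftrightarrow>
     (\<forall>l\<in>A. \<forall>v w. is_factor v u \<and> is_factor w u \<and> length v = length w \<longrightarrow>
        \<bar>int (count_list v l) - int (count_list w l)\<bar> \<le> int c)"

text \<open>
  For finite nonempty \<open>A\<close> the set is finite and nonempty (its elements lie between \<open>0\<close> and \<open>n\<close>),
  so \<^const>\<open>Max\<close> is the genuine maximum.
\<close>

definition balance_function :: "'a set \<Rightarrow> 'a word \<Rightarrow> nat \<Rightarrow> int" where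
  "balance_function A u n =
     Max {\<bar>int (count_list w a) - int (count_list w' a)\<bar> | a w w'.
            a \<in> A \<and> is_factor w u \<and> is_factor w' u \<and> length w = n \<and> length w' = n}"

section \<open>Normal U-representation\<close>

definition subst_lengths :: "(nat \<Rightarrow> nat list) \<Rightarrow> nat \<Rightarrow> nat" where
  "subst_lengths \<phi> j = length ((subst_word \<phi> ^^ j) [0])"

text \<open>The greedy digits of \<open>n\<close> with respect to \<open>U\<^sub>k, \<dots>, U\<^sub>0\<close>, most significant digit first.\<close>

fun greedy_digits :: "(nat \<Rightarrow> nat) \<Rightarrow> nat \<Rightarrow> nat \<Rightarrow> nat list" where
  "greedy_digits U 0 n = [n div U 0]"
| "greedy_digits U (Suc k) n = (n div U (Suc k)) # greedy_digits U k (n mod U (Suc k))"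

text \<open>Only meaningful for \<open>n \<ge> 1\<close> and strictly increasing \<open>U\<close> with \<open>U\<^sub>0 = 1\<close>.\<close>

definition normal_rep :: "(nat \<Rightarrow> nat) \<Rightarrow> nat \<Rightarrow> nat list" where
  "normal_rep U n = greedy_digits U (THE k. U k \<le> n \<and> n < U (Suc k)) n"

section \<open>Deterministic finite automata with output\<close>

record ('q, 'a, 'b) dfao =
  states :: "'q set"
  input_alphabet :: "'a set"
  trans_fun :: "'q \<Rightarrow> 'a \<Rightarrow> 'q"
  init_state :: 'q
  output_alphabet :: "'b set"
  output_fun :: "'q \<Rightarrow> 'b"

definition is_dfao :: "('q, 'a, 'b) dfao \<Rightarrow> bool" where
  "is_dfao M \<longleftrightarrow>
     finite (states M) \<and> finite (input_alphabet M) \<and> finite (output_alphabet M) \<and>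
     init_state M \<in> states M \<and>
     (\<forall>q\<in>states M. \<forall>a\<in>input_alphabet M. trans_fun M q a \<in> states M) \<and>
     (\<forall>q\<in>states M. output_fun M q \<in> output_alphabet M)"

definition dfao_output :: "('q, 'a, 'b) dfao \<Rightarrow> 'a list \<Rightarrow> 'b" where
  "dfao_output M w = output_fun M (foldl (trans_fun M) (init_state M) w)"

text \<open>
  Automaticity of \<open>(a\<^sub>n)\<^sub>n\<^sub>\<ge>\<^sub>1\<close>; the value \<open>a 0\<close> is ignored, and \<open>b\<close> is the largest digit.
  Taking natural numbers as states is no restriction, as the set of states is finite. The
  membership in \<^const>\<open>lists\<close> says that the representation is a word over the input alphabet, on
  which alone the transition function is constrained; for \<open>U\<close> coming from a Parry substitution
  and \<open>b = \<alpha>\<^sub>0\<close> it always holds.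
\<close>

definition U_automatic :: "(nat \<Rightarrow> nat) \<Rightarrow> nat \<Rightarrow> (nat \<Rightarrow> 'b) \<Rightarrow> bool" where
  "U_automatic U b a \<longleftrightarrow>
     (\<exists>M :: (nat, nat, 'b) dfao.
        is_dfao M \<and> input_alphabet M = {0..b} \<and>
        (\<forall>n\<ge>1. normal_rep U n \<in> lists (input_alphabet M) \<and>
                a n = dfao_output M (normal_rep U n)))"

end

theory Submission
  imports Defs
begin

text \<open>
  The balance function at \<open>n\<close> is determined by the differences between the Parikh vectors of the
  factors of length \<open>n\<close> and that of the prefix of length \<open>n\<close>. Balance confines these differences to
  a finite set, so the idea is to let an automaton compute the set of differences while it reads
  the digits of \<open>n\<close>.

  Appending a digit \<open>a\<close> replaces the prefix \<open>v\<close> by \<open>\<phi>(v) 0\<^sup>a\<close>. A factor near the new length lies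
  inside the image of a factor \<open>u\<^sub>i \<dots> u\<^bsub>j-1\<^esub>\<close> up to offsets within the images of \<open>u\<^sub>i\<close> and \<open>u\<^sub>j\<close>, and its
  difference to the new prefix is a linear function of the old difference, up to corrections
  that depend only on \<open>u\<^sub>i\<close>, \<open>u\<^sub>j\<close>, the offsets and \<open>a\<close> (\<open>deviation_subst\<close>). The difference also
  determines the length. The factor \<open>u\<^sub>i \<dots> u\<^bsub>j-1\<^esub>\<close> need not have the length of \<open>v\<close>, so the state
  (\<open>profile\<close>) records differences and end letters for all factors whose length is within \<open>K\<close> of that
  of \<open>v\<close>. For a suitable \<open>K\<close> this is closed under the step (\<open>contraction_radius\<close>): by balance, long
  factors contain many zeros, and \<open>\<phi>\<close> lengthens each of them, so that an excess of more than \<open>K\<close>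
  letters would grow by more than the bounded errors. Hence the profile after a digit depends only
  on the profile before and on the digit (\<open>profile_step_subset\<close>), and there are finitely many
  profiles (\<open>finite_profiles\<close>).

  What links this to representations is that the digits of \<open>n\<close> must produce the prefix of length
  \<open>n\<close>, and initial segments of the digits must produce prefixes of \<open>u\<close> too. This holds for every
  run of the prefix automaton of \<open>\<phi>\<close> (\<open>digit_word_prefix\<close>). Greedy representations are such runs
  (\<open>path_greedy\<close>), because Parry's condition makes \<open>\<phi>\<^sup>k(0)\<close> a longest word among the \<open>\<phi>\<^sup>k(x)\<close>
  (\<open>len_mono_lex\<close>), so that no greedy digit exceeds what the automaton allows.
\<close>


section \<open>Sequences computed by states of a finite set\<close>

text \<open>
  In the style of Myhill and Nerode: instead of exhibiting a transition function it suffices that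
  the state reached after \<open>ds @ [a]\<close> depends only on \<open>a\<close> and the state reached after \<open>ds\<close>, for those
  digit words (the set \<open>P\<close>) that prefixes of representations can be.
\<close>

lemma U_automaticI:
  fixes st :: "nat list \<Rightarrow> 's" and f :: "'s \<Rightarrow> 'b"
  assumes fin: "finite (st ` P)" and nil: "[] \<in> P"
    and pre: "\<And>ds a. ds @ [a] \<in> P \<Longrightarrow> ds \<in> P \<and> a \<le> b"
    and cong: "\<And>ds ds' a. ds @ [a] \<in> P \<Longrightarrow> ds' @ [a] \<in> P \<Longrightarrow> st ds = st ds' \<Longrightarrow>
                 st (ds @ [a]) = st (ds' @ [a])"
    and out: "\<And>n. 1 \<le> n \<Longrightarrow> normal_rep U n \<in> P \<and> g n = f (st (normal_rep U n))"
  shows "U_automatic U b g"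
proof -
  obtain e :: "'s \<Rightarrow> nat" where e: "inj_on e (st ` P)"
    using finite_imp_inj_to_nat_seg[OF fin] by blast
  define h where "h ds = e (st ds)" for ds
  have h_eq: "h ds = h ds' \<longleftrightarrow> st ds = st ds'" if "ds \<in> P" "ds' \<in> P" for ds ds'
    using inj_on_eq_iff[OF e, of "st ds" "st ds'"] that unfolding h_def by blast
  define tr where
    "tr q a = (if \<exists>ds. ds @ [a] \<in> P \<and> h ds = q
               then h ((SOME ds. ds @ [a] \<in> P \<and> h ds = q) @ [a]) else h [])" for q a
  define M :: "(nat, nat, 'b) dfao" where
    "M = \<lparr>states = h ` P, input_alphabet = {0..b}, trans_fun = tr, init_state = h [],
          output_alphabet = f ` st ` P, output_fun = (\<lambda>q. f (inv_into (st ` P) e q))\<rparr>"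
  have tr_h: "tr (h ds) a = h (ds @ [a])" if P: "ds @ [a] \<in> P" for ds a
  proof -
    define ds' where "ds' = (SOME ds'. ds' @ [a] \<in> P \<and> h ds' = h ds)"
    have ex: "\<exists>ds'. ds' @ [a] \<in> P \<and> h ds' = h ds" using P by blast
    have ds': "ds' @ [a] \<in> P \<and> h ds' = h ds"
      unfolding ds'_def by (rule someI_ex[OF ex])
    have "st ds' = st ds" using ds' P pre h_eq by blast
    then have "st (ds' @ [a]) = st (ds @ [a])" using cong ds' P by blast
    then show ?thesis using ex by (simp add: tr_def ds'_def h_def)
  qed
  have tr_in: "tr q a \<in> h ` P" for q a
  proof (cases "\<exists>ds. ds @ [a] \<in> P \<and> h ds = q")
    case True
    then show ?thesis
      using someI_ex[OF True] unfolding tr_def by auto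
  next
    case False
    then show ?thesis using nil unfolding tr_def by auto
  qed
  have run: "foldl tr (h []) ds = h ds" if "ds \<in> P" for ds
    using that
  proof (induction ds rule: rev_induct)
    case (snoc a ds)
    then show ?case using pre[of ds a] tr_h[of ds a] by simp
  qed simp
  have digits: "ds \<in> lists {0..b}" if "ds \<in> P" for ds
    using that
  proof (induction ds rule: rev_induct)
    case (snoc a ds)
    then show ?case using pre[of ds a] by simp
  qed simp
  have out_h: "f (inv_into (st ` P) e (h ds)) = f (st ds)" if "ds \<in> P" for ds
    using that e by (simp add: h_def)
  have "is_dfao M"
    using fin nil tr_in out_h unfolding is_dfao_def M_def h_def[abs_def]
    by (auto simp: image_image[symmetric, of e st])
  moreover have "normal_rep U n \<in> lists (input_alphabet M) \<and>
      g n = dfao_output M (normal_rep U n)" if "1 \<le> n" for n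
    using out[OF that] digits out_h run unfolding M_def dfao_output_def by auto
  ultimately show ?thesis
    unfolding U_automatic_def by (intro exI[of _ M]) (simp add: M_def)
qed


section \<open>Substitutions acting on words\<close>

lemma subst_word_append: "subst_word \<phi> (v @ w) = subst_word \<phi> v @ subst_word \<phi> w"
  by (simp add: subst_word_def)

lemma subst_word_Cons: "subst_word \<phi> (x # w) = \<phi> x @ subst_word \<phi> w"
  by (simp add: subst_word_def)

lemma subst_word_Nil: "subst_word \<phi> [] = []"
  by (simp add: subst_word_def)

lemma subst_pow_Nil: "(subst_word \<phi> ^^ k) [] = []"
  by (induction k) (simp_all add: subst_word_Nil)

lemma subst_pow_append:
  "(subst_word \<phi> ^^ k) (v @ w) = (subst_word \<phi> ^^ k) v @ (subst_word \<phi> ^^ k) w"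
  by (induction k) (simp_all add: subst_word_append)

lemma length_subst_pow_replicate:
  "length ((subst_word \<phi> ^^ k) (replicate a x)) = a * length ((subst_word \<phi> ^^ k) [x])"
proof (induction a)
  case (Suc a)
  have "replicate (Suc a) x = [x] @ replicate a x" by simp
  then show ?case using Suc subst_pow_append[of k \<phi> "[x]" "replicate a x"] by simp
qed (simp add: subst_pow_Nil)

lemma count_list_replicate: "count_list (replicate n x) y = (if x = y then n else 0)"
  by (induction n) auto

lemma sum_list_count:
  fixes g :: "nat \<Rightarrow> int"
  assumes "set w \<subseteq> {..<d}"
  shows "(\<Sum>x\<leftarrow>w. g x) = (\<Sum>x<d. int (count_list w x) * g x)"
  using assms
proof (induction w)
  case (Cons y w)
  have "y < d" using Cons.prems by simp
  then have y: "(\<Sum>x<d. if y = x then g x else 0) = g y"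
    by (subst sum.delta') auto
  have "(\<Sum>x<d. int (count_list (y # w) x) * g x) =
        (\<Sum>x<d. (if y = x then g x else 0) + int (count_list w x) * g x)"
    by (intro sum.cong) (auto simp: algebra_simps)
  then show ?case using Cons y by (simp add: sum.distrib)
qed simp

lemma count_subst_word:
  fixes w :: "nat list"
  assumes "set w \<subseteq> {..<d}"
  shows "int (count_list (subst_word \<phi> w) l) =
         (\<Sum>x<d. int (count_list w x) * int (count_list (\<phi> x) l))"
proof -
  have "int (count_list (subst_word \<phi> w) l) = (\<Sum>x\<leftarrow>w. int (count_list (\<phi> x) l))"
    by (induction w) (simp_all add: subst_word_Cons subst_word_Nil)
  then show ?thesis using sum_list_count[OF assms] by simp
qed

lemma length_subst_word:
  fixes w :: "nat list"
  assumes "set w \<subseteq> {..<d}"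
  shows "int (length (subst_word \<phi> w)) = (\<Sum>x<d. int (count_list w x) * int (length (\<phi> x)))"
proof -
  have "int (length (subst_word \<phi> w)) = (\<Sum>x\<leftarrow>w. int (length (\<phi> x)))"
    by (induction w) (simp_all add: subst_word_Cons subst_word_Nil)
  then show ?thesis using sum_list_count[OF assms] by simp
qed

text \<open>
  For the digits \<open>d\<^sub>k, \<dots>, d\<^sub>0\<close> this is \<open>\<phi>\<^sup>k(0)\<^bsup>d\<^sub>k\<^esup> \<dots> \<phi>(0)\<^bsup>d\<^sub>1\<^esup> 0\<^bsup>d\<^sub>0\<^esup>\<close>. The scheme of
  Horner makes it a function that reads digits from the most significant one on.
\<close>

definition digit_word :: "(nat \<Rightarrow> nat list) \<Rightarrow> nat list \<Rightarrow> nat list" where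
  "digit_word \<phi> ds = foldl (\<lambda>w a. subst_word \<phi> w @ replicate a 0) [] ds"

lemma digit_word_Nil: "digit_word \<phi> [] = []"
  by (simp add: digit_word_def)

lemma digit_word_snoc:
  "digit_word \<phi> (ds @ [a]) = subst_word \<phi> (digit_word \<phi> ds) @ replicate a 0"
  by (simp add: digit_word_def)

lemma length_digit_word_greedy:
  "length (digit_word \<phi> (greedy_digits (subst_lengths \<phi>) k n)) = n"
proof -
  let ?U = "subst_lengths \<phi>" and ?step = "\<lambda>w a. subst_word \<phi> w @ replicate a 0"
  have "length (foldl ?step w (greedy_digits ?U k n)) =
        length ((subst_word \<phi> ^^ Suc k) w) + n" for w
  proof (induction k arbitrary: n w)
    case 0
    then show ?case by (simp add: subst_lengths_def)
  next
    case (Suc k)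
    let ?a = "n div ?U (Suc k)"
    have "length (foldl ?step w (greedy_digits ?U (Suc k) n)) =
          length ((subst_word \<phi> ^^ Suc k) (subst_word \<phi> w @ replicate ?a 0)) +
          n mod ?U (Suc k)"
      using Suc.IH by simp
    also have "\<dots> = length ((subst_word \<phi> ^^ Suc (Suc k)) w) + (?a * ?U (Suc k) + n mod ?U (Suc k))"
      unfolding subst_pow_append length_append length_subst_pow_replicate
      by (simp add: subst_lengths_def funpow_swap1)
    also have "\<dots> = length ((subst_word \<phi> ^^ Suc (Suc k)) w) + n"
      by (simp only: div_mult_mod_eq)
    finally show ?case .
  qed
  from this[of "[]"] show ?thesis
    by (simp only: digit_word_def subst_pow_Nil) simp
qed


section \<open>Greedy representations as paths of the prefix automaton\<close>

text \<open>
  The simple and the non-simple case are treated together by unrolling the alphabet along the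
  Parry digits \<open>t\<^sub>0, t\<^sub>1, \<dots>\<close>: the \<open>i\<close>-th unrolled letter is \<open>letter i\<close>, as a word of length at most
  one, and it is mapped to \<open>0\<^bsup>t\<^sub>i\<^esup>\<close> followed by the next unrolled letter. In the simple case
  \<open>letter i\<close> becomes empty after the last letter; in the non-simple case it is periodic.
\<close>

locale parry_unrolling =
  fixes d :: nat and t :: "nat \<Rightarrow> nat" and letter :: "nat \<Rightarrow> nat list" and \<phi> :: "nat \<Rightarrow> nat list"
  assumes d2: "2 \<le> d"
    and letter_less: "x < d \<Longrightarrow> letter x = [x]"
    and set_letter: "set (letter i) \<subseteq> {..<d}"
    and length_letter: "length (letter i) \<le> 1"
    and letter_end: "letter i = [] \<Longrightarrow> letter (Suc i) = []"
    and subst_letter: "subst_word \<phi> (letter i) = replicate (t i) 0 @ letter (Suc i)"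
    and t_le: "t i \<le> t 0"
    and parry: "1 \<le> i \<Longrightarrow> \<exists>j. t (i + j) < t j \<and> (\<forall>l<j. t (i + l) = t l)"
    and t_recurs: "i < d \<Longrightarrow> \<exists>k. 0 < t (i + k)"
begin

abbreviation U :: "nat \<Rightarrow> nat" where "U \<equiv> subst_lengths \<phi>"

definition len :: "nat \<Rightarrow> nat \<Rightarrow> nat" where
  "len k i = length ((subst_word \<phi> ^^ k) (letter i))"

lemma letter_0: "letter 0 = [0]"
  using d2 letter_less by simp

lemma letter_end_add: "letter i = [] \<Longrightarrow> letter (i + j) = []"
  by (induction j) (auto intro: letter_end)

lemma letter_Nil_digit: "letter i = [] \<Longrightarrow> t i = 0"
  using subst_letter[of i] by (simp add: subst_word_Nil)

lemma letter_nonempty: "0 < t (i + j) \<Longrightarrow> letter i \<noteq> []"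
  using letter_end_add[of i j] letter_Nil_digit[of "i + j"] by auto

lemma subst_of_letter: "x < d \<Longrightarrow> \<phi> x = replicate (t x) 0 @ letter (Suc x)"
  using subst_letter[of x] letter_less[of x] by (simp add: subst_word_Cons subst_word_Nil)

lemma t0_pos: "0 < t 0"
  proof -
  obtain j where "t (1 + j) < t j" using parry[of 1] by auto
  then show ?thesis using t_le[of j] by linarith
qed

lemma subst_nonempty: 
  assumes "x < d"
  shows "\<phi> x \<noteq> []"
proof -
  obtain k where k: "0 < t (x + k)" using t_recurs[OF assms] by blast
  show ?thesis
  proof (cases k)
    case 0
    then show ?thesis using k subst_of_letter[OF assms] by simp
  next
    case (Suc k')
    then show ?thesis
      using k letter_nonempty[of "Suc x" k'] subst_of_letter[OF assms] by simp
  qed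
qed

lemma set_subst: "x < d \<Longrightarrow> set (\<phi> x) \<subseteq> {..<d}"
  using subst_of_letter[of x] set_letter[of "Suc x"] d2 by auto

lemma length_subst_le: "x < d \<Longrightarrow> length (\<phi> x) \<le> t 0 + 1"
  using subst_of_letter[of x] length_letter[of "Suc x"] t_le[of x] by simp

lemma length_subst_0: "2 \<le> length (\<phi> 0)"
  using subst_of_letter[of 0] letter_less[of 1] d2 t0_pos by simp

lemma len_0: "len 0 i = length (letter i)"
  by (simp add: len_def)

lemma len_first: "len k 0 = U k"
  by (simp add: len_def letter_0 subst_lengths_def)

lemma len_Suc: "len (Suc k) i = t i * U k + len k (Suc i)"
proof -
  have "(subst_word \<phi> ^^ Suc k) (letter i) =
        (subst_word \<phi> ^^ k) (replicate (t i) 0 @ letter (Suc i))"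
    by (simp add: funpow_swap1 subst_letter)
  then show ?thesis
    by (simp add: len_def subst_pow_append length_subst_pow_replicate subst_lengths_def)
qed

text \<open>
  Parry's condition ensures that no \<open>\<phi>\<^sup>k(letter i)\<close> is longer than \<open>\<phi>\<^sup>k(0)\<close>. The lengths obey
  \<open>len (k + 1) i = t\<^sub>i U\<^sub>k + len k (i + 1)\<close>, so they are ordered like the digit sequences
  \<open>t\<^sub>i t\<^bsub>i+1\<^esub> \<dots>\<close>: where these first differ the larger digit contributes an additional \<open>U\<^sub>k\<close>, which
  by induction outweighs everything that follows. If they agree throughout, what remains to be
  compared is the lengths of two single letters, and \<open>i' \<le> i\<close> gives these the right order,
  since letters only ever become empty.
\<close>

lemma len_mono_lex:
  assumes "i' \<le> i" and "t (i + j) < t (i' + j)" and "\<forall>l<j. t (i + l) = t (i' + l)"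
  shows "len k i \<le> len k i'"
  using assms
proof (induction k arbitrary: i i' j)
  case 0
  then show ?case
    using letter_end_add[of i' "i - i'"] length_letter[of i]
    by (cases "letter i'") (auto simp: len_0)
next
  case (Suc k)
  show ?case
  proof (cases j)
    case 0
    obtain j' where "t (Suc i + j') < t j'" "\<forall>l<j'. t (Suc i + l) = t l"
      using parry[of "Suc i"] by auto
    then have "len k (Suc i) \<le> len k 0"
      using Suc.IH[of 0 "Suc i" j'] by simp
    then have "len (Suc k) i \<le> (t i + 1) * U k"
      by (simp add: len_Suc len_first)
    also have "\<dots> \<le> t i' * U k"
      using Suc.prems 0 by (intro mult_right_mono) auto
    also have "\<dots> \<le> len (Suc k) i'" by (simp add: len_Suc)
    finally show ?thesis .
  next
    case (Suc j')
    have "t i = t i'" using Suc.prems(3) Suc by force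
    moreover have "len k (Suc i) \<le> len k (Suc i')"
      using Suc.prems Suc by (intro Suc.IH[of "Suc i'" "Suc i" j']) auto
    ultimately show ?thesis by (simp add: len_Suc)
  qed
qed

lemma len_le: "len k i \<le> U k"
proof (cases "i = 0")
  case False
  then obtain j where "t (i + j) < t j" "\<forall>l<j. t (i + l) = t l"
    using parry[of i] by auto
  then show ?thesis using len_mono_lex[of 0 i j k] by (simp add: len_first)
qed (simp add: len_first)

text \<open>
  The runs of the prefix automaton of \<open>\<phi>\<close> from the letter \<open>0\<close>: in state \<open>i\<close> the last \<open>i\<close> digits read
  are \<open>t\<^sub>0 \<dots> t\<^bsub>i-1\<^esub>\<close>, and \<open>letter i\<close> is the letter that follows the word of the digits read in the
  fixed point. The digit \<open>a\<close> selects the letter with index \<open>a\<close> in the image of \<open>letter i\<close>.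
\<close>

inductive path :: "nat list \<Rightarrow> nat \<Rightarrow> bool" where
  path_Nil: "path [] 0"
| path_less: "path ds i \<Longrightarrow> a < t i \<Longrightarrow> path (ds @ [a]) 0"
| path_eq: "path ds i \<Longrightarrow> letter (Suc i) \<noteq> [] \<Longrightarrow> path (ds @ [t i]) (Suc i)"

lemma path_snocD:
  assumes "path (ds @ [a]) j"
  shows "\<exists>i. path ds i \<and> a \<le> t i"
  using assms by (cases rule: path.cases) auto

text \<open>
  The digit \<open>n div U\<^sub>k\<close> cannot exceed \<open>t\<^sub>i\<close> because \<open>n < t\<^sub>i U\<^sub>k + len k (i + 1) \<le> (t\<^sub>i + 1) U\<^sub>k\<close>, and the
  remainder satisfies the same bound for the new state.
\<close>

lemma path_greedy:
  assumes "n < len (Suc k) i" and "path ds i"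
  shows "\<exists>j. path (ds @ greedy_digits U k n) j"
  using assms
proof (induction k arbitrary: n i ds)
  case 0
  have U0: "U 0 = 1" by (simp add: subst_lengths_def)
  have n: "n < t i + length (letter (Suc i))"
    using 0 by (simp add: len_Suc len_0 U0)
  show ?case
  proof (cases "n < t i")
    case True
    then show ?thesis using path_less[OF 0(2), of n] by (auto simp: U0)
  next
    case False
    then have "letter (Suc i) \<noteq> []" "n = t i"
      using n length_letter[of "Suc i"] by auto
    then show ?thesis using path_eq[OF 0(2)] by (auto simp: U0)
  qed
next
  case (Suc k)
  define a r where "a = n div U (Suc k)" and "r = n mod U (Suc k)"
  have n: "n = a * U (Suc k) + r" by (simp only: a_def r_def div_mult_mod_eq)
  have lt: "n < t i * U (Suc k) + len (Suc k) (Suc i)"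
    using Suc.prems(1) len_Suc[of "Suc k" i] by simp
  then have "n < (t i + 1) * U (Suc k)"
    using len_le[of "Suc k" "Suc i"] by simp
  then have pos: "0 < U (Suc k)" by (auto intro: gr0I)
  have a_le: "a \<le> t i"
    using \<open>n < (t i + 1) * U (Suc k)\<close> less_mult_imp_div_less[of n "t i + 1" "U (Suc k)"]
    unfolding a_def by linarith
  have r: "r < U (Suc k)" using pos by (simp add: r_def)
  have greedy: "greedy_digits U (Suc k) n = a # greedy_digits U k r"
    by (simp add: a_def r_def)
  show ?case
  proof (cases "a < t i")
    case True
    then show ?thesis
      using Suc.IH[of r 0 "ds @ [a]"] r path_less[OF Suc.prems(2)] greedy
      by (simp add: len_first)
  next
    case False
    then have a: "a = t i" using a_le by simp
    then have r': "r < len (Suc k) (Suc i)" using n lt by simp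
    then have "letter (Suc i) \<noteq> []"
      by (auto simp: len_def subst_pow_Nil simp del: funpow.simps)
    then show ?thesis
      using Suc.IH[of r "Suc i" "ds @ [a]"] r' path_eq[OF Suc.prems(2)] greedy a by simp
  qed
qed

lemma subst_word_nonempty:
  assumes "set w \<subseteq> {..<d}" and "w \<noteq> []"
  shows "set (subst_word \<phi> w) \<subseteq> {..<d} \<and> subst_word \<phi> w \<noteq> []"
proof -
  obtain x w' where w: "w = x # w'" using assms(2) by (cases w) auto
  then have "subst_word \<phi> w \<noteq> []"
    using assms(1) subst_nonempty[of x] by (simp add: subst_word_Cons)
  moreover have "set (subst_word \<phi> w) \<subseteq> {..<d}"
    using assms(1) set_subst unfolding subst_word_def by fastforce
  ultimately show ?thesis by blast
qed

lemma subst_pow_nonempty: "(subst_word \<phi> ^^ k) [1] \<noteq> []"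
proof -
  have "set ((subst_word \<phi> ^^ k) [1]) \<subseteq> {..<d} \<and> (subst_word \<phi> ^^ k) [1] \<noteq> []"
  proof (induction k)
    case (Suc k)
    then show ?case using subst_word_nonempty[of "(subst_word \<phi> ^^ k) [1]"] by simp
  qed (use d2 in simp)
  then show ?thesis by blast
qed

lemma U_strict_mono: "strict_mono U"
proof (intro strict_mono_Suc_iff[THEN iffD2] allI)
  fix k
  have "0 < len k 1"
    using subst_pow_nonempty[of k] letter_less[of 1] d2 by (simp add: len_def)
  then have "U k < t 0 * U k + len k 1"
    using t0_pos by (cases "t 0") auto
  then show "U k < U (Suc k)"
    using len_Suc[of k 0] by (simp add: len_first)
qed

lemma normal_rep_greedy:
  assumes "1 \<le> n"
  shows "\<exists>k. normal_rep U n = greedy_digits U k n \<and> n < U (Suc k)"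
proof -
  have "n < U (Suc n)"
    using strict_mono_imp_increasing[OF U_strict_mono, of "Suc n"] by simp
  define K where "K = (LEAST K. n < U (Suc K))"
  have K: "n < U (Suc K)"
    unfolding K_def using \<open>n < U (Suc n)\<close> by (rule LeastI)
  have "U K \<le> n"
  proof (cases K)
    case 0
    then show ?thesis using assms by (simp add: subst_lengths_def)
  next
    case (Suc K')
    then show ?thesis
      using not_less_Least[of K' "\<lambda>K. n < U (Suc K)"] by (simp add: K_def)
  qed
  have "(THE k. U k \<le> n \<and> n < U (Suc k)) = K"
  proof (rule the_equality)
    show "U K \<le> n \<and> n < U (Suc K)" using K \<open>U K \<le> n\<close> by blast
    fix k assume k: "U k \<le> n \<and> n < U (Suc k)"
    then have "U k < U (Suc K)" "U K < U (Suc k)"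
      using K \<open>U K \<le> n\<close> by linarith+
    then show "k = K"
      using strict_mono_less[OF U_strict_mono] by simp
  qed
  then show ?thesis using K by (auto simp: normal_rep_def)
qed

lemma path_normal_rep:
  assumes "1 \<le> n"
  shows "\<exists>j. path (normal_rep U n) j"
proof -
  obtain k where k: "normal_rep U n = greedy_digits U k n" "n < U (Suc k)"
    using normal_rep_greedy[OF assms] by blast
  then show ?thesis
    using path_greedy[OF _ path_Nil, of n k] by (simp add: len_first)
qed

lemma length_normal_rep: "1 \<le> n \<Longrightarrow> length (digit_word \<phi> (normal_rep U n)) = n"
  using normal_rep_greedy length_digit_word_greedy by metis

end

section \<open>Desubstitution in a balanced fixed point\<close>

locale balanced_parry_word = parry_unrolling +
  fixes u :: "nat word" and c :: nat
  assumes fixed: "is_fixed_point {..<d} \<phi> u"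
    and bal: "balanced {..<d} c u"
begin

text \<open>The image of \<open>u x\<close> under the substitution occupies the positions from \<open>start x\<close> on.\<close>

definition start :: "nat \<Rightarrow> nat" where
  "start x = length (subst_word \<phi> (prefix x u))"

lemma u_less: "u x < d"
  using fixed unfolding is_fixed_point_def by blast

lemma set_factor: "set (u [i \<rightarrow> j]) \<subseteq> {..<d}"
  using u_less by auto

lemma subst_prefix: "subst_word \<phi> (prefix x u) = prefix (start x) u"
  using fixed unfolding is_fixed_point_def start_def by blast

lemma start_0: "start 0 = 0"
  by (simp add: start_def subst_word_Nil)

lemma start_Suc: "start (Suc x) = start x + length (\<phi> (u x))"
  by (simp add: start_def subst_word_append subst_word_Cons subst_word_Nil)

lemma start_ge: "x \<le> start x"
proof (induction x)
  case (Suc x)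
  then show ?case
    using subst_nonempty[OF u_less[of x]] by (cases "\<phi> (u x)") (auto simp: start_Suc)
qed simp

lemma factor_append: "i \<le> j \<Longrightarrow> prefix j u = prefix i u @ (u [i \<rightarrow> j])"
  using subsequence_append[where i = i and j = "j - i" and w = u] by simp

lemma u_start: 
  assumes "r < length (\<phi> (u x))"
  shows "u (start x + r) = \<phi> (u x) ! r"
proof -
  have "subst_word \<phi> (prefix (Suc x) u) = prefix (start x) u @ \<phi> (u x)"
    by (simp add: subst_word_append subst_word_Cons subst_word_Nil subst_prefix)
  moreover have "subst_word \<phi> (prefix (Suc x) u) =
      prefix (start x) u @ (u [start x \<rightarrow> start (Suc x)])"
    unfolding subst_prefix by (rule factor_append) (simp add: start_Suc)
  ultimately have "\<phi> (u x) = (u [start x \<rightarrow> start (Suc x)])" by simp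
  moreover have "(u [start x \<rightarrow> start (Suc x)]) ! r = u (start x + r)"
    using assms by (simp add: start_Suc)
  ultimately show ?thesis by metis
qed

lemma prefix_start:
  assumes "r \<le> length (\<phi> (u x))"
  shows "prefix (start x + r) u = subst_word \<phi> (prefix x u) @ take r (\<phi> (u x))"
proof -
  have "(u [start x \<rightarrow> start x + r]) = take r (\<phi> (u x))"
    using assms u_start[of _ x] by (intro nth_equalityI) auto
  then show ?thesis
    using factor_append[of "start x" "start x + r"] by (simp add: subst_prefix)
qed

lemma start_decomp: "\<exists>x r. y = start x + r \<and> r < length (\<phi> (u x))"
proof (induction y)
  case 0
  then show ?case
    using subst_nonempty[OF u_less[of 0]] start_0 by (intro exI[of _ 0]) simp
next
  case (Suc y)
  then obtain x r where x: "y = start x + r" "r < length (\<phi> (u x))" by blast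
  show ?case
  proof (cases "Suc r < length (\<phi> (u x))")
    case True
    then show ?thesis using x by (intro exI[of _ x] exI[of _ "Suc r"]) simp
  next
    case False
    then have "Suc y = start (Suc x) + 0" using x by (simp add: start_Suc)
    then show ?thesis
      using subst_nonempty[OF u_less[of "Suc x"]] by blast
  qed
qed

text \<open>
  \<open>u (start x)\<close> is the first letter of the image of \<open>u x\<close>. While the Parry digits vanish this is the
  next unrolled letter, and at the first positive digit it is \<open>0\<close>. Starting at position \<open>0\<close>, which
  is fixed by \<open>start\<close>, this shows \<open>u 0 = 0\<close>; starting elsewhere, that zeros recur.
\<close>

lemma zero_in_orbit:
  assumes "letter i = [u x]" and "0 < t (i + k)"
  shows "\<exists>n. u ((start ^^ n) x) = 0"
  using assms
proof (induction k arbitrary: i x)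
  case 0
  then have "\<phi> (u x) = replicate (t i) 0 @ letter (Suc i)"
    using subst_letter[of i] by (simp add: subst_word_Cons subst_word_Nil)
  then have "u (start x) = 0" using 0 u_start[of 0 x] by (simp add: nth_append)
  then show ?case by (intro exI[of _ 1]) simp
next
  case (Suc k)
  have im: "\<phi> (u x) = replicate (t i) 0 @ letter (Suc i)"
    using Suc.prems subst_letter[of i] by (simp add: subst_word_Cons subst_word_Nil)
  show ?case
  proof (cases "t i = 0")
    case True
    have "letter (Suc i) \<noteq> []" using letter_nonempty[of "Suc i" k] Suc.prems by simp
    then obtain y where y: "letter (Suc i) = [y]"
      using length_letter[of "Suc i"] by (cases "letter (Suc i)") auto
    then have "letter (Suc i) = [u (start x)]"
      using True im u_start[of 0 x] by simp
    then obtain n where "u ((start ^^ n) (start x)) = 0"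
      using Suc.IH[of "Suc i" "start x"] Suc.prems by auto
    then show ?thesis by (intro exI[of _ "Suc n"]) (simp add: funpow_swap1)
  next
    case False
    then have "u (start x) = 0" using im u_start[of 0 x] by (simp add: nth_append)
    then show ?thesis by (intro exI[of _ 1]) simp
  qed
qed

lemma zero_orbit: "\<exists>n. u ((start ^^ n) x) = 0"
  using zero_in_orbit[OF letter_less[OF u_less]] t_recurs[OF u_less] by blast

lemma u_0: "u 0 = 0"
proof -
  have "(start ^^ n) 0 = 0" for n by (induction n) (simp_all add: start_0)
  then show ?thesis using zero_orbit[of 0] by simp
qed

lemma zeros_recur: "\<exists>y\<ge>x. u y = 0"
proof -
  have "x \<le> (start ^^ n) x" for n
    by (induction n) (auto intro: order_trans start_ge)
  then show ?thesis using zero_orbit[of x] by blast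
qed

lemma prefix_many_zeros: "\<exists>N. z \<le> count_list (prefix N u) 0"
proof (induction z)
  case (Suc z)
  then obtain N where N: "z \<le> count_list (prefix N u) 0" by blast
  obtain y where y: "N \<le> y" "u y = 0" using zeros_recur by blast
  have "Suc z \<le> count_list (prefix (Suc y) u) 0"
    using N y factor_append[OF y(1)] by simp
  then show ?case by blast
qed simp

lemma is_factor_seq: "is_factor (u [i \<rightarrow> j]) u"
  unfolding is_factor_def by blast

text \<open>Balance transports the zeros of a long prefix to every factor of the same length.\<close>

lemma factors_many_zeros: "\<exists>N. \<forall>x. z \<le> count_list (u [x \<rightarrow> x + N]) 0"
proof -
  obtain N where N: "z + c \<le> count_list (prefix N u) 0" using prefix_many_zeros by blast
  have "z \<le> count_list (u [x \<rightarrow> x + N]) 0" for x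
  proof -
    have "\<bar>int (count_list (prefix N u) 0) - int (count_list (u [x \<rightarrow> x + N]) 0)\<bar> \<le> int c"
      using bal d2 is_factor_seq unfolding balanced_def by simp
    then show ?thesis using N by linarith
  qed
  then show ?thesis by blast
qed

lemma start_growth:
  assumes "x \<le> y"
  shows "start x + (y - x) + count_list (u [x \<rightarrow> y]) 0 \<le> start y"
  using assms
proof (induction y rule: dec_induct)
  case (step y)
  have "1 \<le> length (\<phi> (u y))"
    using subst_nonempty[OF u_less[of y]] by (cases "\<phi> (u y)") auto
  then show ?case
    using step length_subst_0 by (auto simp: start_Suc Suc_diff_le)
qed simp

lemma start_expands: "\<exists>K. \<forall>x y. x + K < y \<longrightarrow> start x + (y - x) + z \<le> start y"
proof -
  obtain N where N: "\<And>x. z \<le> count_list (u [x \<rightarrow> x + N]) 0"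
    using factors_many_zeros by blast
  have "start x + (y - x) + z \<le> start y" if "x + N < y" for x y
    using start_growth[of x "x + N"] start_growth[of "x + N" y] N[of x] that by simp
  then show ?thesis by blast
qed

lemma start_near_factor:
  assumes "v = prefix (length v) u"
  shows "\<bar>int (start (i + length v)) - int (start i) - int (length (subst_word \<phi> v))\<bar>
         \<le> int (d * (c * (t 0 + 1)))"
proof -
  let ?w = "u [i \<rightarrow> i + length v]"
  have "subst_word \<phi> (prefix (i + length v) u) = subst_word \<phi> (prefix i u) @ subst_word \<phi> ?w"
    by (simp add: subsequence_append subst_word_append)
  then have "int (start (i + length v)) - int (start i) = int (length (subst_word \<phi> ?w))"
    by (simp add: start_def)
  moreover have "set v \<subseteq> {..<d}" by (subst assms) (rule set_factor)
  ultimately have "int (start (i + length v)) - int (start i) - int (length (subst_word \<phi> v)) =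
      (\<Sum>x<d. (int (count_list ?w x) - int (count_list v x)) * int (length (\<phi> x)))"
    by (simp add: length_subst_word[OF set_factor] length_subst_word
        left_diff_distrib sum_subtractf)
  also have "\<bar>\<dots>\<bar> \<le> (\<Sum>x<d. int (c * (t 0 + 1)))"
  proof (rule order_trans[OF sum_abs sum_mono])
    fix x assume x: "x \<in> {..<d}"
    have "is_factor v u" using assms is_factor_seq by metis
    then have "\<bar>int (count_list ?w x) - int (count_list v x)\<bar> \<le> int c"
      using bal x is_factor_seq unfolding balanced_def by simp
    moreover have "int (length (\<phi> x)) \<le> int (t 0 + 1)"
      using length_subst_le[of x] x by simp
    ultimately show "\<bar>(int (count_list ?w x) - int (count_list v x)) * int (length (\<phi> x))\<bar>
        \<le> int (c * (t 0 + 1))"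
      unfolding abs_mult of_nat_mult by (intro mult_mono) auto
  qed
  finally show ?thesis by simp
qed

text \<open>
  If two positions in \<open>u\<close> lie at a distance within \<open>K\<close> of the length of the next reference prefix,
  then so do their preimages with respect to the current one. Hence the window of pairs of
  positions with slack \<open>K\<close> can be propagated from one digit to the next.
\<close>

definition contracting :: "nat \<Rightarrow> bool" where
  "contracting K \<longleftrightarrow> (\<forall>v a i j r s. v = prefix (length v) u \<longrightarrow> a \<le> t 0 \<longrightarrow>
     r < length (\<phi> (u i)) \<longrightarrow> s < length (\<phi> (u j)) \<longrightarrow>
     \<bar>int (start j + s) - int (start i + r) - int (length (subst_word \<phi> v @ replicate a 0))\<bar> \<le> int K
     \<longrightarrow> \<bar>int j - int i - int (length v)\<bar> \<le> int K)"

text \<open>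
  The images of balanced factors of equal length differ in length by a bounded amount, whereas a
  surplus of more than \<open>K\<close> letters contains so many zeros, each of which gains a letter, that its
  image exceeds \<open>K\<close> by more than this amount.
\<close>

lemma contraction_radius: "\<exists>K. contracting K"
proof -
  define E where "E = d * (c * (t 0 + 1))"
  \<comment> \<open>Besides \<open>E\<close>, the two offsets within images of letters and the digit have to be absorbed.\<close>
  obtain K where K: "\<And>x y. x + K < y \<Longrightarrow> start x + (y - x) + (E + 3 * (t 0 + 1)) \<le> start y"
    using start_expands by blast
  have "contracting K"
    unfolding contracting_def
  proof (intro allI impI)
    fix v a i j r s
    assume v: "v = prefix (length v) u" and a: "a \<le> t 0"
      and r: "r < length (\<phi> (u i))" and s: "s < length (\<phi> (u j))"
      and near: "\<bar>int (start j + s) - int (start i + r)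
                   - int (length (subst_word \<phi> v @ replicate a 0))\<bar> \<le> int K"
    let ?j = "i + length v"
    have r': "r \<le> t 0 + 1" using r length_subst_le[OF u_less[of i]] by linarith
    have s': "s \<le> t 0 + 1" using s length_subst_le[OF u_less[of j]] by linarith
    have "\<bar>int (start ?j) - int (start i) - int (length (subst_word \<phi> v))\<bar> \<le> int E"
      unfolding E_def by (rule start_near_factor[OF v])
    then have dist: "\<bar>int (start j) - int (start ?j)\<bar> \<le> int K + int E + int (3 * (t 0 + 1))"
      using near r' s' a by simp
    show "\<bar>int j - int i - int (length v)\<bar> \<le> int K"
    proof (rule ccontr)
      assume "\<not> ?thesis"
      then consider "?j + K < j" | "j + K < ?j" by linarith
      then show False
      proof cases
        case 1
        then show False using K[OF 1] dist by linarith
      next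
        case 2
        then show False using K[OF 2] dist by linarith
      qed
    qed
  qed
  then show ?thesis by blast
qed


section \<open>Parikh vectors of factors relative to a prefix\<close>

text \<open>
  The difference between the Parikh vector of \<open>u\<^sub>i \<dots> u\<^bsub>j-1\<^esub>\<close> and that of \<open>v\<close>. The factor is
  represented by two prefixes of \<open>u\<close>, so that the expression stays meaningful, and additive, when
  \<open>j < i\<close>.
\<close>

definition deviation :: "nat list \<Rightarrow> nat \<Rightarrow> nat \<Rightarrow> nat \<Rightarrow> int" where
  "deviation v i j =
     (\<lambda>l. int (count_list (prefix j u) l) - int (count_list (prefix i u) l)
          - int (count_list v l))"

text \<open>
  The state of the automaton. The letters at both ends are recorded because the images of these
  letters are where the next pair of positions lies.
\<close>

definition profile :: "nat \<Rightarrow> nat list \<Rightarrow> ((nat \<Rightarrow> int) \<times> nat \<times> nat) set" where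
  "profile K v = {(deviation v i j, u i, u j) | i j. \<bar>int j - int i - int (length v)\<bar> \<le> int K}"

lemma deviation_outside:
  assumes "set v \<subseteq> {..<d}" and "d \<le> l"
  shows "deviation v i j l = 0"
proof -
  have "count_list w l = 0" if "set w \<subseteq> {..<d}" for w
    using that assms(2) by (intro count_notin) auto
  then show ?thesis
    using assms(1) set_factor unfolding deviation_def by simp
qed

lemma sum_deviation:
  assumes "set v \<subseteq> {..<d}"
  shows "(\<Sum>l<d. deviation v i j l) = int j - int i - int (length v)"
proof -
  have "(\<Sum>l<d. int (count_list w l)) = int (length w)" if "set w \<subseteq> {..<d}" for w
    using sum_count_set[OF that] by (simp flip: of_nat_sum)
  then show ?thesis
    using assms set_factor[of 0] by (simp add: deviation_def sum_subtractf)
qed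

lemma count_prefix_diff:
  "\<bar>int (count_list (prefix x u) l) - int (count_list (prefix y u) l)\<bar> \<le> \<bar>int x - int y\<bar>"
proof -
  have "\<bar>int (count_list (prefix x u) l) - int (count_list (prefix y u) l)\<bar> \<le> \<bar>int x - int y\<bar>"
    if "x \<le> y" for x y
    using factor_append[OF that] count_le_length[of "u [x \<rightarrow> y]" l] that by simp
  from this[of x y] this[of y x] show ?thesis by linarith
qed

lemma deviation_factor:
  "deviation v i (i + n) l = int (count_list (u [i \<rightarrow> i + n]) l) - int (count_list v l)"
  using subsequence_append[where i = i and j = n and w = u] by (simp add: deviation_def)

lemma deviation_bounded:
  assumes v: "v = prefix (length v) u" and "l < d"
    and "\<bar>int j - int i - int (length v)\<bar> \<le> int K"
  shows "\<bar>deviation v i j l\<bar> \<le> int (c + K)"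
proof -
  let ?j = "i + length v"
  have "is_factor v u" using v is_factor_seq by metis
  then have "\<bar>deviation v i ?j l\<bar> \<le> int c"
    using bal assms(2) is_factor_seq unfolding balanced_def deviation_factor by simp
  moreover have "deviation v i j l - deviation v i ?j l =
      int (count_list (prefix j u) l) - int (count_list (prefix ?j u) l)"
    by (simp add: deviation_def)
  moreover have "\<bar>\<dots>\<bar> \<le> int K"
    using count_prefix_diff[of j l ?j] assms(3) by simp
  ultimately show ?thesis by linarith
qed

lemma finite_profiles: "finite {profile K v | v. v = prefix (length v) u}"
proof -
  define F where "F = {f :: nat \<Rightarrow> int. \<forall>l. (l \<in> {..<d} \<longrightarrow> f l \<in> {- int (c + K)..int (c + K)}) \<and>
                                          (l \<notin> {..<d} \<longrightarrow> f l = 0)}"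
  have "finite F" unfolding F_def by (rule finite_set_of_finite_funs) auto
  then have fin: "finite (Pow (F \<times> {..<d} \<times> {..<d}))" by simp
  have "profile K v \<subseteq> F \<times> {..<d} \<times> {..<d}" if v: "v = prefix (length v) u" for v
  proof -
    have "set v \<subseteq> {..<d}" by (subst v) (rule set_factor)
    have "deviation v i j \<in> F" if near: "\<bar>int j - int i - int (length v)\<bar> \<le> int K" for i j
    proof -
      have "deviation v i j l \<in> {- int (c + K)..int (c + K)}" if "l < d" for l
        using deviation_bounded[OF v that near] unfolding abs_le_iff atLeastAtMost_iff by linarith
      then show ?thesis
        using deviation_outside[OF \<open>set v \<subseteq> {..<d}\<close>] unfolding F_def by simp
    qed
    then show ?thesis using u_less unfolding profile_def by auto
  qed
  then have "{profile K v | v. v = prefix (length v) u} \<subseteq> Pow (F \<times> {..<d} \<times> {..<d})" by blast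
  then show ?thesis using fin by (rule finite_subset)
qed

text \<open>
  Parikh vectors transform linearly under the substitution. Hence neither the positions nor the
  reference prefix enter the new deviation except through the old one and the letters at the ends.
\<close>

lemma deviation_subst:
  assumes "set v \<subseteq> {..<d}" and "r < length (\<phi> (u i))" and "s < length (\<phi> (u j))"
  shows "deviation (subst_word \<phi> v @ replicate a 0) (start i + r) (start j + s) l =
    (\<Sum>x<d. deviation v i j x * int (count_list (\<phi> x) l))
    + int (count_list (take s (\<phi> (u j))) l) - int (count_list (take r (\<phi> (u i))) l)
    - int (count_list (replicate a 0) l)"
  using assms
  by (simp add: deviation_def prefix_start count_subst_word[OF set_factor] count_subst_word
      left_diff_distrib sum_subtractf)

lemma set_subst_digit:
  assumes "set v \<subseteq> {..<d}"
  shows "set (subst_word \<phi> v @ replicate a 0) \<subseteq> {..<d}"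
  using assms set_subst d2 unfolding subst_word_def by fastforce

text \<open>
  Every pair of positions near the next reference prefix comes from a pair in the current profile
  and two offsets. Equal profiles supply an equivalent pair elsewhere in \<open>u\<close>; the same offsets then
  lead to the same deviation, which also determines the distance of the new positions.
\<close>

lemma profile_step_subset:
  assumes K: "contracting K"
    and v: "v = prefix (length v) u" and w: "w = prefix (length w) u" and a: "a \<le> t 0"
    and eq: "profile K v = profile K w"
  shows "profile K (subst_word \<phi> v @ replicate a 0) \<subseteq> profile K (subst_word \<phi> w @ replicate a 0)"
proof
  let ?v = "subst_word \<phi> v @ replicate a 0" and ?w = "subst_word \<phi> w @ replicate a 0"
  have sv: "set v \<subseteq> {..<d}" by (subst v) (rule set_factor)
  have sw: "set w \<subseteq> {..<d}" by (subst w) (rule set_factor)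
  fix p assume "p \<in> profile K ?v"
  then obtain i' j' where p: "p = (deviation ?v i' j', u i', u j')"
    and near: "\<bar>int j' - int i' - int (length ?v)\<bar> \<le> int K"
    unfolding profile_def by blast
  obtain i r where i: "i' = start i + r" "r < length (\<phi> (u i))" using start_decomp by blast
  obtain j s where j: "j' = start j + s" "s < length (\<phi> (u j))" using start_decomp by blast
  have "\<bar>int j - int i - int (length v)\<bar> \<le> int K"
    using K v a i j near unfolding contracting_def by blast
  then have "(deviation v i j, u i, u j) \<in> profile K v"
    unfolding profile_def by blast
  then have "(deviation v i j, u i, u j) \<in> profile K w"
    unfolding eq .
  then obtain x y where xy: "deviation w x y = deviation v i j" "u x = u i" "u y = u j"
    unfolding profile_def by auto
  have dev: "deviation ?w (start x + r) (start y + s) = deviation ?v i' j'"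
    using deviation_subst[OF sw, of r x s y a] deviation_subst[OF sv, of r i s j a] i j xy
    by (intro ext) simp
  have "int (start y + s) - int (start x + r) - int (length ?w) =
        (\<Sum>l<d. deviation ?w (start x + r) (start y + s) l)"
    using sum_deviation[OF set_subst_digit[OF sw]] by simp
  also have "\<dots> = int j' - int i' - int (length ?v)"
    unfolding dev using sum_deviation[OF set_subst_digit[OF sv]] by simp
  finally have "\<bar>int (start y + s) - int (start x + r) - int (length ?w)\<bar> \<le> int K"
    using near by simp
  then have "(deviation ?w (start x + r) (start y + s), u (start x + r), u (start y + s))
      \<in> profile K ?w"
    unfolding profile_def by blast
  moreover have "u (start x + r) = u i'" "u (start y + s) = u j'"
    using u_start i j xy by simp_all
  ultimately show "p \<in> profile K ?w" using dev p by simp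
qed

text \<open>
  The entries of a deviation add up to a difference of lengths, so these are the deviations of the
  factors that have exactly the length of the reference prefix.
\<close>

definition zero_sum :: "((nat \<Rightarrow> int) \<times> nat \<times> nat) set \<Rightarrow> (nat \<Rightarrow> int) set" where
  "zero_sum S = {f \<in> fst ` S. (\<Sum>l<d. f l) = 0}"

lemma zero_sum_profile:
  assumes "set v \<subseteq> {..<d}"
  shows "zero_sum (profile K v) = range (\<lambda>i. deviation v i (i + length v))"
proof (intro equalityI subsetI)
  fix f assume f: "f \<in> zero_sum (profile K v)"
  then obtain i j where ij: "f = deviation v i j"
    unfolding zero_sum_def profile_def by auto
  then have "j = i + length v"
    using f sum_deviation[OF assms, of i j] unfolding zero_sum_def by simp
  then show "f \<in> range (\<lambda>i. deviation v i (i + length v))" using ij by blast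
next
  fix f assume "f \<in> range (\<lambda>i. deviation v i (i + length v))"
  then obtain i where i: "f = deviation v i (i + length v)" by blast
  have "\<bar>int (i + length v) - int i - int (length v)\<bar> \<le> int K" by simp
  then have "(f, u i, u (i + length v)) \<in> profile K v"
    unfolding profile_def i by blast
  then have "f \<in> fst ` profile K v" by force
  then show "f \<in> zero_sum (profile K v)"
    using i sum_deviation[OF assms, of i "i + length v"] unfolding zero_sum_def by simp
qed

lemma factors_of_length: "{w. is_factor w u \<and> length w = n} = range (\<lambda>i. u [i \<rightarrow> i + n])"
proof (intro equalityI subsetI)
  fix w assume w: "w \<in> {w. is_factor w u \<and> length w = n}"
  then obtain i j where ij: "w = (u [i \<rightarrow> j])" unfolding is_factor_def by blast
  then have "j - i = n" using w by simp
  then have "w = (u [i \<rightarrow> i + n])"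
    using ij by (cases "i \<le> j") (auto simp: le_imp_diff_is_add add.commute)
  then show "w \<in> range (\<lambda>i. u [i \<rightarrow> i + n])" by blast
qed (use is_factor_seq in auto)

lemma balance_function_profile:
  assumes v: "v = prefix (length v) u"
  shows "balance_function {..<d} u (length v) =
    Max {\<bar>f a - g a\<bar> | a f g.
          a < d \<and> f \<in> zero_sum (profile K v) \<and> g \<in> zero_sum (profile K v)}"
proof -
  let ?n = "length v"
  have sv: "set v \<subseteq> {..<d}" by (subst v) (rule set_factor)
  have "{\<bar>int (count_list w a) - int (count_list w' a)\<bar> | a w w'.
          a \<in> {..<d} \<and> is_factor w u \<and> is_factor w' u \<and> length w = ?n \<and> length w' = ?n} =
        {\<bar>int (count_list w a) - int (count_list w' a)\<bar> | a w w'. a < d \<and>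
          w \<in> {w. is_factor w u \<and> length w = ?n} \<and> w' \<in> {w. is_factor w u \<and> length w = ?n}}"
    by (intro Collect_cong) auto
  also have "\<dots> = {\<bar>int (count_list (u [i \<rightarrow> i + ?n]) a) - int (count_list (u [j \<rightarrow> j + ?n]) a)\<bar>
                     | a i j. a < d}"
    unfolding factors_of_length by blast
  also have "\<dots> = {\<bar>deviation v i (i + ?n) a - deviation v j (j + ?n) a\<bar> | a i j. a < d}"
    by (simp add: deviation_factor)
  also have "\<dots> = {\<bar>f a - g a\<bar> | a f g.
          a < d \<and> f \<in> zero_sum (profile K v) \<and> g \<in> zero_sum (profile K v)}"
    unfolding zero_sum_profile[OF sv] by blast
  finally show ?thesis unfolding balance_function_def by simp
qed


section \<open>The profile as a state after reading digits\<close>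

lemma append_eq_prefixD:
  assumes "v @ w = prefix n u"
  shows "v = prefix (length v) u"
proof -
  have "length v \<le> n" using arg_cong[OF assms, of length] by simp
  moreover have "v = take (length v) (prefix n u)" by (simp flip: assms)
  ultimately show ?thesis by (simp add: min_def)
qed

text \<open>
  The statement includes the next letter so that it passes through the substitution: applying
  \<open>\<phi>\<close> to the prefix yields a prefix that contains all continuations allowed by the automaton.
\<close>

lemma digit_word_prefix:
  assumes "path ds i"
  shows "digit_word \<phi> ds @ letter i = prefix (length (digit_word \<phi> ds @ letter i)) u"
  using assms
proof (induction rule: path.induct)
  case path_Nil
  then show ?case by (simp add: digit_word_Nil letter_0 u_0)
next
  case (path_less ds i a)
  have "subst_word \<phi> (digit_word \<phi> ds @ letter i) =
        digit_word \<phi> (ds @ [a]) @ replicate (t i - a) 0 @ letter (Suc i)"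
    using path_less.hyps replicate_add[of a "t i - a" "0::nat"]
    by (simp add: subst_word_append subst_letter digit_word_snoc)
  moreover obtain n where "subst_word \<phi> (digit_word \<phi> ds @ letter i) = prefix n u"
    using subst_prefix path_less.IH by metis
  moreover obtain m where "t i - a = Suc m"
    using path_less.hyps by (metis Suc_diff_Suc)
  ultimately have "prefix n u = (digit_word \<phi> (ds @ [a]) @ letter 0) @ replicate m 0 @ letter (Suc i)"
    by (simp add: letter_0)
  then show ?case by (rule append_eq_prefixD[OF sym])
next
  case (path_eq ds i)
  have "subst_word \<phi> (digit_word \<phi> ds @ letter i) = digit_word \<phi> (ds @ [t i]) @ letter (Suc i)"
    by (simp add: subst_word_append subst_letter digit_word_snoc)
  moreover obtain n where "subst_word \<phi> (digit_word \<phi> ds @ letter i) = prefix n u"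
    using subst_prefix path_eq.IH by metis
  ultimately have "digit_word \<phi> (ds @ [t i]) @ letter (Suc i) = prefix n u" by simp
  then show ?case by (metis subsequence_length diff_zero)
qed

lemma digit_word_is_prefix:
  assumes "path ds i"
  shows "digit_word \<phi> ds = prefix (length (digit_word \<phi> ds)) u"
  by (rule append_eq_prefixD[OF digit_word_prefix[OF assms]])

lemma U_automatic_balance: "U_automatic U (t 0) (balance_function {..<d} u)"
proof -
  obtain K where K: "contracting K"
    using contraction_radius by blast
  define P where "P = {ds. \<exists>i. path ds i}"
  define F where "F S = Max {\<bar>f a - g a\<bar> | a f g. a < d \<and> f \<in> zero_sum S \<and> g \<in> zero_sum S}" for S
  have pre: "ds \<in> P \<and> a \<le> t 0" if "ds @ [a] \<in> P" for ds a
    using that path_snocD t_le unfolding P_def by (blast intro: order_trans)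
  have prefix: "digit_word \<phi> ds = prefix (length (digit_word \<phi> ds)) u" if "ds \<in> P" for ds
    using that digit_word_is_prefix unfolding P_def by blast
  show ?thesis
  proof (rule U_automaticI[where P = P and st = "\<lambda>ds. profile K (digit_word \<phi> ds)" and f = F])
    have "(\<lambda>ds. profile K (digit_word \<phi> ds)) ` P \<subseteq> {profile K v | v. v = prefix (length v) u}"
      using prefix by blast
    then show "finite ((\<lambda>ds. profile K (digit_word \<phi> ds)) ` P)"
      by (rule finite_subset[OF _ finite_profiles])
    show "[] \<in> P" unfolding P_def using path_Nil by blast
    show "ds \<in> P \<and> a \<le> t 0" if "ds @ [a] \<in> P" for ds a using pre that by blast
    show "profile K (digit_word \<phi> (ds @ [a])) = profile K (digit_word \<phi> (ds' @ [a]))"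
      if "ds @ [a] \<in> P" "ds' @ [a] \<in> P"
        and eq: "profile K (digit_word \<phi> ds) = profile K (digit_word \<phi> ds')" for ds ds' a
    proof -
      have "ds \<in> P" "ds' \<in> P" "a \<le> t 0" using pre that by blast+
      then show ?thesis
        unfolding digit_word_snoc
        using profile_step_subset[OF K prefix[of ds] prefix[of ds']]
          profile_step_subset[OF K prefix[of ds'] prefix[of ds]] eq by blast
    qed
    fix n :: nat assume n: "1 \<le> n"
    have "normal_rep U n \<in> P" using path_normal_rep[OF n] unfolding P_def by blast
    then show "normal_rep U n \<in> P \<and>
        balance_function {..<d} u n = F (profile K (digit_word \<phi> (normal_rep U n)))"
      using balance_function_profile[OF prefix, of "normal_rep U n" K] length_normal_rep[OF n]
      unfolding F_def by simp
  qed
qed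

end

section \<open>Unrolling simple and non-simple Parry substitutions\<close>

lemma parry_unrolling_simple:
  assumes "simple_parry_params m \<alpha>"
  shows "parry_unrolling m (\<lambda>i. if i < m then \<alpha> i else 0) (\<lambda>i. if i < m then [i] else [])
           (simple_parry_subst m \<alpha>)"
proof -
  let ?t = "\<lambda>i. if i < m then \<alpha> i else 0"
  have m: "2 \<le> m" and le: "\<forall>l<m. \<alpha> l \<le> \<alpha> 0" and last: "1 \<le> \<alpha> (m - 1)"
    and cond: "parry_condition (map \<alpha> [0..<m] \<frown> [0]\<^sup>\<omega>)"
    using assms unfolding simple_parry_params_def by auto
  have t: "map \<alpha> [0..<m] \<frown> [0]\<^sup>\<omega> = ?t"
    by (auto simp: fun_eq_iff conc_def iter_def)
  show ?thesis
  proof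
    show "\<exists>k. 0 < ?t (i + k)" if "i < m" for i
      using that last by (intro exI[of _ "m - 1 - i"]) auto
    show "\<exists>j. ?t (i + j) < ?t j \<and> (\<forall>l<j. ?t (i + l) = ?t l)" if "1 \<le> i" for i
      using cond that unfolding t parry_condition_def less_fun_def suffix_nth by blast
  qed (use m le in \<open>auto simp: simple_parry_subst_def subst_word_def\<close>)
qed

lemma parry_unrolling_nonsimple:
  fixes m p :: nat and wrap :: "nat \<Rightarrow> nat"
  assumes "nonsimple_parry_params m p \<alpha>"
  defines "wrap \<equiv> \<lambda>i. if i < m then i else m + (i - m) mod p"
  shows "parry_unrolling (m + p) (\<lambda>i. \<alpha> (wrap i)) (\<lambda>i. [wrap i]) (nonsimple_parry_subst m p \<alpha>)"
proof -
  have m: "1 \<le> m" and p: "1 \<le> p" and le: "\<forall>l<m + p. \<alpha> l \<le> \<alpha> 0"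
    and pos: "\<exists>l\<in>{m..<m + p}. 1 \<le> \<alpha> l"
    and cond: "parry_condition (map \<alpha> [0..<m] \<frown> (map \<alpha> [m..<m + p])\<^sup>\<omega>)"
    using assms(1) unfolding nonsimple_parry_params_def by auto
  have t: "map \<alpha> [0..<m] \<frown> (map \<alpha> [m..<m + p])\<^sup>\<omega> = (\<lambda>i. \<alpha> (wrap i))"
    using p by (auto simp: fun_eq_iff conc_def iter_def wrap_def)
  have wrap_less: "wrap i < m + p" for i
    using p by (simp add: wrap_def)
  have wrap_id: "wrap i = i" if "i < m + p" for i
    using that by (simp add: wrap_def)
  have wrap_Suc: "wrap (Suc i) = (if Suc (wrap i) < m + p then Suc (wrap i) else m)" for i
  proof (cases "i < m")
    case True
    then show ?thesis using p by (auto simp: wrap_def)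
  next
    case False
    then have "wrap (Suc i) = m + Suc (i - m) mod p" "wrap i = m + (i - m) mod p"
      by (auto simp: wrap_def Suc_diff_le)
    moreover have "(i - m) mod p < p" using p by simp
    ultimately show ?thesis by (auto simp: mod_Suc)
  qed
  obtain l where l: "m \<le> l" "l < m + p" "1 \<le> \<alpha> l" using pos by auto
  have "(l + p - m) mod p = (l - m + p) mod p" using l by (intro arg_cong2[where f = "(mod)"]) auto
  also have "\<dots> = l - m" unfolding mod_add_self2 using l by (intro mod_less) linarith
  finally have wrap_l: "wrap (l + p) = l" using l p by (simp only: wrap_def) simp
  have recurs: "\<exists>k. 0 < \<alpha> (wrap (i + k))" if "i < m + p" for i
    using that l wrap_l by (intro exI[of _ "l + p - i"]) simp
  have parry: "\<exists>j. \<alpha> (wrap (i + j)) < \<alpha> (wrap j) \<and> (\<forall>l<j. \<alpha> (wrap (i + l)) = \<alpha> (wrap l))"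
    if "1 \<le> i" for i
  proof -
    have "less_fun (suffix i (\<lambda>i. \<alpha> (wrap i))) (\<lambda>i. \<alpha> (wrap i))"
      using cond that unfolding t parry_condition_def by simp
    then show ?thesis unfolding less_fun_def suffix_nth .
  qed
  show ?thesis
  proof (unfold_locales, goal_cases)
    case (7 i)
    show ?case using le wrap_less[of i] wrap_id[of 0] m by simp
  next
    case (8 i)
    then show ?case by (rule parry)
  next
    case (9 i)
    then show ?case by (rule recurs)
  qed (use m p wrap_less wrap_id wrap_Suc in
      \<open>auto simp: nonsimple_parry_subst_def subst_word_def\<close>)
qed

lemma parry_substitution_unrolling:
  assumes "parry_substitution d \<alpha> \<phi>"
  shows "\<exists>t letter. parry_unrolling d t letter \<phi> \<and> t 0 = \<alpha> 0"
  using assms unfolding parry_substitution_def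
proof (elim disjE exE conjE)
  fix m assume m: "d = m" "simple_parry_params m \<alpha>" "\<phi> = simple_parry_subst m \<alpha>"
  then have "0 < m" by (simp add: simple_parry_params_def)
  then show ?thesis
    unfolding m(1,3)
    by (intro exI[of _ "\<lambda>i. if i < m then \<alpha> i else 0"] exI[of _ "\<lambda>i. if i < m then [i] else []"]
        conjI parry_unrolling_simple[OF m(2)]) simp
next
  fix m p
  assume m: "d = m + p" "nonsimple_parry_params m p \<alpha>" "\<phi> = nonsimple_parry_subst m p \<alpha>"
  then have "0 < m" by (simp add: nonsimple_parry_params_def)
  let ?wrap = "\<lambda>i. if i < m then i else m + (i - m) mod p"
  from \<open>0 < m\<close> show ?thesis
    unfolding m(1,3)
    by (intro exI[of _ "\<lambda>i. \<alpha> (?wrap i)"] exI[of _ "\<lambda>i. [?wrap i]"]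
        conjI parry_unrolling_nonsimple[OF m(2)]) simp
qed

theorem mainTheorem3:
  fixes d c :: nat
    and \<alpha> :: "nat \<Rightarrow> nat"
    and \<phi> :: "nat \<Rightarrow> nat list"
    and u :: "nat word"
  assumes "parry_substitution d \<alpha> \<phi>"
    and "is_fixed_point {..<d} \<phi> u"
    and "c > 0"
    and "balanced {..<d} c u"
  shows "U_automatic (subst_lengths \<phi>) (\<alpha> 0) (balance_function {..<d} u)"
proof -
  obtain t letter where "parry_unrolling d t letter \<phi>" and t: "t 0 = \<alpha> 0"
    using parry_substitution_unrolling[OF assms(1)] by blast
  then interpret balanced_parry_word d t letter \<phi> u c
    using assms(2,4) by (simp add: balanced_parry_word_def balanced_parry_word_axioms_def)
  show ?thesis using U_automatic_balance unfolding t .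
qed

end
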